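(* Let $1\le q<3$, $m\in\mathbb{R}$, $\sigma>0$, and let $X$ be a real random variable following the $q$-Gaussian distribution $N_q(m,\sigma^2)$, with density $f$. Then: 1. For $\theta\in\mathbb{R}$, $$L_q(X)(\theta)=\left(e_q^{\,\theta m a^{q-1}+\frac{\theta^2a^{2q-2}\sigma^2}{4\beta}}\right)^{\frac{3-q}{2}},\qquad\text{where } a=\frac{\sqrt{\beta}}{\sigma C_q}.$$ 2. $$E_q(X)=\int_{-\infty}^{\infty}x\,(f(x))^q\,dx=\frac{m(3-q)^{\frac{3-q}{2}}}{2(\sigma C_q)^{q-1}}.$$ 3. $$E_{2q-1}(X^2)=\int_{-\infty}^{\infty}x^2(f(x))^{2q-1}\,dx=\frac{1}{4q(3-q)^{q-2}(\sigma C_q)^{2q-2}}\left[(3-q)\sigma^2+(q+1)m^2\right].$$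
   Context: For $q\ge 1$ and real $u$, the $q$-exponential is $e_q^{u}=e_q(u)=[1+(1-q)u]_+^{1/(1-q)}$ for $q\ne1$ (equal to $+\infty$ when $q>1$ and $1+(1-q)u\le 0$), and $e_1^u=\exp(u)$. The $q$-logarithm is $\ln_q(x)=\frac{x^{1-q}-1}{1-q}$ for $x>0$ (with $\ln_1=\ln$). The $q$-product is $x\otimes_q y=[x^{1-q}+y^{1-q}-1]_+^{1/(1-q)}$ (ordinary product for $q=1$), used with the rule $e_q^{u}\otimes_q e_q^{v}=e_q^{u+v}$ for real $u,v$; thus for $y>0$, $e_q^{u}\otimes_q y=e_q^{u+\ln_q y}=[(1-q)u+y^{1-q}]_+^{1/(1-q)}$ when $q\neq 1$. For $1\le q<3$ put $\beta=\frac{1}{3-q}$ and $C_q=\int_{-\infty}^{\infty}e_q^{-x^2}\,dx$, so that $C_1=\sqrt{\pi}$ and $C_q=\left(\frac{1}{q-1}\right)^{1/2}B\!\left(\frac{3-q}{2(q-1)},\frac12\right)$ for $1<q<3$, where $B$ is the beta function. The $q$-Gaussian distribution $N_q(m,\sigma^2)$ has density $f(x)=\frac{\sqrt{\beta}}{\sigma C_q}e_q^{-\beta(x-m)^2/\sigma^2}$, $x\in\mathbb{R}$. The $q$-Laplace transform of a random variable $X$ with density $f$ is $L_q(X)(\theta)=\int_{\mathrm{supp} f}e_q^{\theta x}\otimes_q f(x)\,dx$ (Lebesgue integral). The unnormalized moments are $E_r(X^k)=\int_{-\infty}^{\infty}x^k(f(x))^r\,dx$. *)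

theory Defs
  imports "HOL-Probability.Probability"
begin

text \<open>The bracket \<open>[t]\<^sub>+\<close> raised to the power \<open>1/(1-q)\<close>, for \<open>q \<noteq> 1\<close>, with values in \<open>[0,\<infinity>]\<close>.
  For \<open>q > 1\<close> the exponent is negative, so the value is \<open>\<infinity>\<close> when \<open>t \<le> 0\<close>.\<close>

definition q_bracket :: "real \<Rightarrow> real \<Rightarrow> ennreal" where
  "q_bracket q t = (if t > 0 then ennreal (t powr (1 / (1 - q)))
                    else if q > 1 then \<infinity> else 0)"

definition q_exp :: "real \<Rightarrow> real \<Rightarrow> ennreal" where
  "q_exp q u = (if q = 1 then ennreal (exp u) else q_bracket q (1 + (1 - q) * u))"

definition q_ln :: "real \<Rightarrow> real \<Rightarrow> real" where
  "q_ln q x = (if q = 1 then ln x else (x powr (1 - q) - 1) / (1 - q))"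

definition q_prod :: "real \<Rightarrow> real \<Rightarrow> real \<Rightarrow> ennreal" where
  "q_prod q x y = (if q = 1 then ennreal (x * y)
                   else q_bracket q (x powr (1 - q) + y powr (1 - q) - 1))"

text \<open>The product of \<open>q_exp q u\<close> and \<open>y > 0\<close>, governed by the rule that q-exponents add up.
  It is a function of the exponent \<open>u\<close> and not of the value \<open>q_exp q u\<close>: for \<open>q > 1\<close> every
  \<open>u \<ge> 1/(q-1)\<close> gives \<open>q_exp q u = \<infinity>\<close>, and the rule still distinguishes these \<open>u\<close>.
  Where \<open>q_exp q u\<close> is finite the two readings agree, see \<open>q_exp_prod_eq_q_prod\<close>.\<close>

definition q_exp_prod :: "real \<Rightarrow> real \<Rightarrow> real \<Rightarrow> ennreal" where
  "q_exp_prod q u y = q_exp q (u + q_ln q y)"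

lemma q_exp_prod_eq_q_bracket:
  assumes "q \<noteq> 1"
  shows "q_exp_prod q u y = q_bracket q ((1 - q) * u + y powr (1 - q))"
proof -
  have "1 + (1 - q) * (u + q_ln q y) = (1 - q) * u + y powr (1 - q)"
    using assms by (simp add: q_ln_def distrib_left)
  then show ?thesis
    using assms by (simp add: q_exp_prod_def q_exp_def)
qed

lemma q_exp_prod_eq_q_prod:
  assumes "y > 0" and "q = 1 \<or> 1 + (1 - q) * u > 0"
  shows "q_exp_prod q u y = q_prod q (enn2real (q_exp q u)) y"
proof (cases "q = 1")
  case True
  then show ?thesis
    using assms by (simp add: q_exp_prod_def q_exp_def q_prod_def q_ln_def exp_add)
next
  case False
  then have pos: "1 + (1 - q) * u > 0" using assms by simp
  have "enn2real (q_exp q u) powr (1 - q) = 1 + (1 - q) * u"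
    using False pos by (simp add: q_exp_def q_bracket_def powr_powr)
  then show ?thesis
    using False by (simp add: q_exp_prod_eq_q_bracket q_prod_def)
qed

definition q_beta :: "real \<Rightarrow> real" where
  "q_beta q = 1 / (3 - q)"

definition q_const :: "real \<Rightarrow> real" where
  "q_const q = (LBINT x. enn2real (q_exp q (- (x\<^sup>2))))"

definition q_gaussian_density :: "real \<Rightarrow> real \<Rightarrow> real \<Rightarrow> real \<Rightarrow> real" where
  "q_gaussian_density q m \<sigma> x =
     sqrt (q_beta q) / (\<sigma> * q_const q) *
     enn2real (q_exp q (- q_beta q * (x - m)\<^sup>2 / \<sigma>\<^sup>2))"

text \<open>For \<open>q \<ge> 1\<close> the argument of \<open>q_exp\<close> in the density is nonpositive, hence its value is
  finite and \<open>enn2real\<close> loses nothing (likewise in \<open>q_const\<close>).\<close>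

lemma q_exp_nonpos_finite:
  assumes "q \<ge> 1" and "u \<le> 0"
  shows "0 < q_exp q u" and "q_exp q u < \<infinity>"
proof -
  have "(1 - q) * u \<ge> 0" using assms by (simp add: mult_nonpos_nonpos)
  then have "1 + (1 - q) * u > 0" by simp
  then show "0 < q_exp q u" and "q_exp q u < \<infinity>"
    by (simp_all add: q_exp_def q_bracket_def)
qed

text \<open>The q-Laplace transform and the unnormalized moments of a random variable with density \<open>f\<close>.
  The transform is a Lebesgue integral of a \<open>[0,\<infinity>]\<close>-valued function and may be \<open>\<infinity>\<close>.\<close>

definition q_laplace :: "real \<Rightarrow> (real \<Rightarrow> real) \<Rightarrow> real \<Rightarrow> ennreal" where
  "q_laplace q f \<theta> = (\<integral>\<^sup>+ x \<in> support_on UNIV f. q_exp_prod q (\<theta> * x) (f x) \<partial>lborel)"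

definition unnorm_moment_integrand :: "real \<Rightarrow> nat \<Rightarrow> (real \<Rightarrow> real) \<Rightarrow> real \<Rightarrow> real" where
  "unnorm_moment_integrand r k f x = x ^ k * f x powr r"

definition unnorm_moment :: "real \<Rightarrow> nat \<Rightarrow> (real \<Rightarrow> real) \<Rightarrow> real" where
  "unnorm_moment r k f = (LBINT x. unnorm_moment_integrand r k f x)"

text \<open>Real powers on \<open>[0,\<infinity>]\<close>, intended for exponents \<open>p > 0\<close>, so that \<open>\<infinity>\<close> is mapped to \<open>\<infinity>\<close>.\<close>

definition ennreal_powr :: "ennreal \<Rightarrow> real \<Rightarrow> ennreal" where
  "ennreal_powr x p = (if x = \<infinity> then \<infinity> else ennreal (enn2real x powr p))"

end

theory Submission
  imports Defs "HOL-Real_Asymp.Real_Asymp"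
begin

text \<open>
  Write \<open>E y = q_exp q (- (A * y\<^sup>2))\<close> with \<open>A = q_beta q / \<sigma>\<^sup>2\<close> (the function \<open>q_kernel\<close> below), so
  that the density is \<open>a * E (x - m)\<close>. The constant \<open>q_const q\<close> is the integral of the kernel
  with \<open>A = 1\<close>, so a rescaling of the line gives \<open>q_const q / sqrt A\<close> for the integral of
  \<open>E\<close>. A density has mass one, so the hypothesis that \<open>X\<close> has this density forces the defining
  integral of \<open>q_const q\<close> to converge to a positive number (\<open>q_gaussian_normalizable\<close>), and then
  \<open>a * (q_const q / sqrt A) = 1\<close>.

  For the Laplace transform, everything rests on one form of the addition rule, in which
  \<open>q_exp q u\<close> splits off at the price of rescaling the other exponent (\<open>q_exp_add\<close>):
  \<open>q_exp q (u + v) = q_exp q u * q_exp q (v / D)\<close> with \<open>D = 1 + (1 - q) * u > 0\<close>. With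
  \<open>u = q_ln q a\<close> it turns the q-product in the integrand into the ordinary product of \<open>a\<close> with
  \<open>q_exp q\<close> of a quadratic polynomial in \<open>x\<close>. Completing the square makes this
  \<open>q_exp q (K - A * y\<^sup>2)\<close> with \<open>K\<close> the exponent of the claim, and the rule with \<open>u = K\<close> leaves
  \<open>q_exp q K\<close> times the kernel for \<open>A / D\<close>. The rescaling of that kernel contributes
  \<open>sqrt D = q_exp q K powr ((1 - q) / 2)\<close>, whence the exponent
  \<open>1 + (1 - q) / 2 = (3 - q) / 2\<close>. If \<open>D \<le> 0\<close>, both sides are infinite: the integral dominates
  the integrals for all smaller \<open>K\<close> with \<open>D > 0\<close>, and these are unbounded
  (\<open>nn_integral_q_exp_quadratic\<close>).

  For the moments, the kernel satisfies the differential equation \<open>E' = - 2 * A * y * E powr q\<close>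
  and the algebraic relation \<open>E powr (1 - q) = 1 + (q - 1) * A * y\<^sup>2\<close>. Integration by parts of
  \<open>y * E powr r\<close> expresses the second moment of \<open>E powr (r + q - 1)\<close> through the mass of
  \<open>E powr r\<close>, and the algebraic relation then gives the mass of \<open>E powr (r + q - 1)\<close>
  (\<open>q_kernel_powr_moments\<close>). Taking \<open>r = 1\<close> leads from \<open>E\<close> to \<open>E powr q\<close>, taking \<open>r = q\<close> leads
  on to \<open>E powr (2 * q - 1)\<close>; these are the two powers in the claim, and the shift from \<open>x - m\<close>
  to \<open>x\<close> only adds multiples of the mass and of a first moment that vanishes by symmetry. The
  differential equation and the algebraic relation hold for \<open>q = 1\<close> as well, so the Gaussian case
  follows the same computation.
\<close>

section \<open>Algebra of the q-exponential\<close>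

lemma q_exp_mono:
  assumes "1 \<le> q" and "u \<le> v"
  shows "q_exp q u \<le> q_exp q v"
proof (cases "q = 1")
  case True
  then show ?thesis using assms by (simp add: q_exp_def)
next
  case False
  with assms have q: "q > 1" by simp
  have "(1 - q) * v \<le> (1 - q) * u" using assms by (intro mult_left_mono_neg) auto
  then have "1 + (1 - q) * v \<le> 1 + (1 - q) * u" by linarith
  moreover have "q_bracket q x \<le> q_bracket q y" if "y \<le> x" for x y
    using that q by (auto simp: q_bracket_def intro!: powr_mono2')
  ultimately show ?thesis using False by (simp add: q_exp_def)
qed

text \<open>The relation \<open>e powr (1 - q) = 1 + (1 - q) * u\<close> determines the value \<open>e\<close> if \<open>q \<noteq> 1\<close> and
  reads \<open>1 = 1\<close> if \<open>q = 1\<close>; stating it for both lets later arguments avoid a case distinction.\<close>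

lemma q_exp_powr:
  assumes "1 \<le> q" and "0 < 1 + (1 - q) * u"
  obtains e where "0 < e" and "q_exp q u = ennreal e" and "e powr (1 - q) = 1 + (1 - q) * u"
proof (cases "q = 1")
  case True
  then show ?thesis using that[of "exp u"] by (simp add: q_exp_def)
next
  case False
  then show ?thesis
    using assms that[of "(1 + (1 - q) * u) powr (1 / (1 - q))"]
    by (simp add: q_exp_def q_bracket_def powr_powr)
qed

text \<open>The base of the q-exponential factorises:
  \<open>1 + (1 - q) * (u + v) = D * (1 + (1 - q) * (v / D))\<close> with \<open>D = 1 + (1 - q) * u\<close>. Only
  \<open>D\<close> has to be positive, so the rule also covers infinite values of the second factor.\<close>

lemma q_exp_add:
  assumes "1 \<le> q" and D: "0 < 1 + (1 - q) * u"
  shows "q_exp q (u + v) = q_exp q u * q_exp q (v / (1 + (1 - q) * u))"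
proof (cases "q = 1")
  case True
  then show ?thesis by (simp add: q_exp_def exp_add ennreal_mult)
next
  case False
  define D where "D = 1 + (1 - q) * u"
  define E where "E = 1 + (1 - q) * (v / D)"
  have "D > 0" using D by (simp add: D_def)
  have "1 + (1 - q) * (u + v) = D + (1 - q) * v"
    by (simp add: D_def algebra_simps)
  also have "\<dots> = D * E"
    using \<open>D > 0\<close> by (simp add: E_def distrib_left)
  finally have DE: "1 + (1 - q) * (u + v) = D * E" .
  have "q_bracket q (D * E) = q_bracket q D * q_bracket q E"
    using \<open>D > 0\<close> assms False
    by (auto simp: q_bracket_def zero_less_mult_iff powr_mult ennreal_mult ennreal_mult_top)
  then show ?thesis
    using False DE by (simp only: q_exp_def E_def D_def[symmetric] if_False)
qed

lemma q_exp_q_ln: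
  assumes "c > 0"
  shows "q_exp q (q_ln q c) = ennreal c"
  using assms by (simp add: q_exp_def q_ln_def q_bracket_def powr_powr)

lemma one_plus_q_ln:
  assumes "c > 0"
  shows "1 + (1 - q) * q_ln q c = c powr (1 - q)"
  using assms by (simp add: q_ln_def)

text \<open>Multiplication by a positive number \<open>c\<close> is an affine change of the exponent.\<close>

lemma q_exp_q_ln_add:
  assumes "1 \<le> q" and "c > 0"
  shows "q_exp q (q_ln q c + c powr (1 - q) * z) = ennreal c * q_exp q z"
  using q_exp_add[of q "q_ln q c" "c powr (1 - q) * z"] assms
  by (simp add: one_plus_q_ln q_exp_q_ln)

lemma q_ln_mult:
  assumes "x > 0" and "y > 0"
  shows "q_ln q (x * y) = q_ln q x + x powr (1 - q) * q_ln q y"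
proof (cases "q = 1")
  case True
  then show ?thesis using assms by (simp add: q_ln_def ln_mult)
next
  case False
  have "x powr (1 - q) * y powr (1 - q) - 1
      = (x powr (1 - q) - 1) + x powr (1 - q) * (y powr (1 - q) - 1)"
    by (simp add: right_diff_distrib)
  then show ?thesis
    using False assms by (simp only: q_ln_def powr_mult if_False add_divide_distrib times_divide_eq_right)
qed

section \<open>The q-Gaussian kernel\<close>

definition q_kernel :: "real \<Rightarrow> real \<Rightarrow> real \<Rightarrow> real" where
  "q_kernel q A y = enn2real (q_exp q (- (A * y\<^sup>2)))"

lemma q_kernel_minus: "q_kernel q A (- y) = q_kernel q A y"
  by (simp add: q_kernel_def)

lemma q_kernel_1: "q_kernel 1 A y = exp (- (A * y\<^sup>2))"
  by (simp add: q_kernel_def q_exp_def)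

lemma q_kernel_eq_powr:
  assumes "1 < q" and "0 < A"
  shows "q_kernel q A y = (1 + (q - 1) * A * y\<^sup>2) powr (- (1 / (q - 1)))"
proof -
  have "1 + (1 - q) * - (A * y\<^sup>2) = 1 + (q - 1) * A * y\<^sup>2" by (simp add: algebra_simps)
  moreover have "1 + (q - 1) * A * y\<^sup>2 > 0" using assms by (simp add: add_pos_nonneg)
  moreover have "1 / (1 - q) = - (1 / (q - 1))"
    using assms by (simp add: field_simps)
  ultimately show ?thesis using assms
    by (simp add: q_kernel_def q_exp_def q_bracket_def)
qed

context
  fixes q A :: real
  assumes q: "1 \<le> q" and A: "0 < A"
begin

lemma q_kernel_base_pos: "0 < 1 + (q - 1) * A * y\<^sup>2"
  using q A by (simp add: add_pos_nonneg)

lemma q_kernel_pos: "0 < q_kernel q A y"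
  using q_exp_nonpos_finite[OF q, of "- (A * y\<^sup>2)"] A
  by (simp add: q_kernel_def enn2real_positive_iff)

lemma ennreal_q_kernel: "ennreal (q_kernel q A y) = q_exp q (- (A * y\<^sup>2))"
  using q_exp_nonpos_finite[OF q, of "- (A * y\<^sup>2)"] A
  by (simp add: q_kernel_def)

lemma q_kernel_powr_1_minus: "q_kernel q A y powr (1 - q) = 1 + (q - 1) * A * y\<^sup>2"
proof (cases "q = 1")
  case True
  then show ?thesis using q_kernel_pos[of y] by simp
next
  case False
  then have "- (1 / (q - 1)) * (1 - q) = 1" by (simp add: field_simps)
  then show ?thesis
    using False q A q_kernel_base_pos[of y]
    by (simp only: q_kernel_eq_powr powr_powr) simp
qed

lemma q_kernel_le_1: "q_kernel q A y \<le> 1"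
proof -
  have "q_exp q (- (A * y\<^sup>2)) \<le> q_exp q 0"
    using q A by (intro q_exp_mono) auto
  also have "\<dots> = 1" by (simp add: q_exp_def q_bracket_def)
  finally show ?thesis
    using q_kernel_pos[of y] by (simp flip: ennreal_q_kernel)
qed

text \<open>This is \<open>q_kernel_powr_1_minus\<close> multiplied by a power of the kernel. It relates the mass and
  the second moment of one power of the kernel to the mass of another.\<close>

lemma q_kernel_powr_split:
  "q_kernel q A y powr r = (1 + (q - 1) * A * y\<^sup>2) * q_kernel q A y powr (r + q - 1)"
proof -
  have r: "r = (1 - q) + (r + q - 1)" by simp
  show ?thesis by (subst r) (simp only: powr_add q_kernel_powr_1_minus)
qed

lemma DERIV_q_kernel:
  "(q_kernel q A has_real_derivative - 2 * A * y * q_kernel q A y powr q) (at y)"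
proof (cases "q = 1")
  case True
  have "((\<lambda>y. exp (- (A * y\<^sup>2))) has_real_derivative - 2 * A * y * exp (- (A * y\<^sup>2))) (at y)"
    by (auto intro!: derivative_eq_intros)
  moreover have "q_kernel q A = (\<lambda>y. exp (- (A * y\<^sup>2)))"
    using True by (auto simp: q_kernel_1)
  ultimately show ?thesis using True by simp
next
  case False
  with q have q1: "1 < q" by simp
  define b where "b = (\<lambda>y. 1 + (q - 1) * A * y\<^sup>2)"
  have b: "b y > 0" unfolding b_def by (rule q_kernel_base_pos)
  have p: "- (1 / (q - 1)) - 1 = - (1 / (q - 1)) * q" using q1 by (simp add: field_simps)
  have alg: "- (1 / (q - 1)) * X * (2 * (q - 1) * A * y) = - 2 * A * y * X" for X
    using q1 by (simp add: field_simps)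
  have "(b has_real_derivative 2 * (q - 1) * A * y) (at y)"
    unfolding b_def by (auto intro!: derivative_eq_intros)
  then have "((\<lambda>y. b y powr (- (1 / (q - 1)))) has_real_derivative
      - (1 / (q - 1)) * b y powr (- (1 / (q - 1)) - 1) * (2 * (q - 1) * A * y)) (at y)"
    by (rule DERIV_chain2[where f = "\<lambda>z. z powr (- (1 / (q - 1)))" and g = b,
          OF has_real_derivative_powr[OF b]])
  also have "- (1 / (q - 1)) * b y powr (- (1 / (q - 1)) - 1) * (2 * (q - 1) * A * y)
      = - 2 * A * y * (b y powr (- (1 / (q - 1)))) powr q"
    unfolding p powr_powr by (rule alg)
  finally have "((\<lambda>y. b y powr (- (1 / (q - 1)))) has_real_derivative
      - 2 * A * y * (b y powr (- (1 / (q - 1)))) powr q) (at y)" .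
  moreover have "q_kernel q A = (\<lambda>y. b y powr (- (1 / (q - 1))))"
    using q1 A by (auto simp: q_kernel_eq_powr b_def)
  ultimately show ?thesis by simp
qed

lemma DERIV_q_kernel_powr:
  "((\<lambda>y. q_kernel q A y powr r) has_real_derivative
     - 2 * A * r * y * q_kernel q A y powr (r + q - 1)) (at y)"
proof -
  have "q_kernel q A y powr (r + q - 1) = q_kernel q A y powr ((r - 1) + q)"
    by (simp add: algebra_simps)
  then have "- 2 * A * r * y * q_kernel q A y powr (r + q - 1)
      = r * q_kernel q A y powr (r - 1) * (- 2 * A * y * q_kernel q A y powr q)"
    by (simp only: powr_add) simp
  then show ?thesis
    using DERIV_chain2[OF has_real_derivative_powr[OF q_kernel_pos] DERIV_q_kernel, of r y]
    by (simp only:)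
qed

lemma continuous_q_kernel_powr: "isCont (\<lambda>y. q_kernel q A y powr r) y"
  using DERIV_q_kernel_powr by (rule DERIV_isCont)

lemma measurable_q_kernel [measurable]: "q_kernel q A \<in> borel_measurable borel"
  by (intro borel_measurable_continuous_onI continuous_at_imp_continuous_on ballI
      DERIV_isCont[OF DERIV_q_kernel])

lemma q_kernel_sqrt: "q_kernel q A y = q_kernel q 1 (sqrt A * y)"
  using A by (simp add: q_kernel_def power_mult_distrib)

text \<open>The boundary term of the integration by parts. For \<open>q > 1\<close> the kernel decays like
  \<open>y powr (- 2 / (q - 1))\<close>, which beats the factor \<open>y\<close> exactly when \<open>q < 3\<close>.\<close>

lemma tendsto_mult_q_kernel:
  assumes "q < 3"
  shows "((\<lambda>y. y * q_kernel q A y) \<longlongrightarrow> 0) at_top"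
proof (cases "q = 1")
  case True
  have "((\<lambda>y. y * exp (- (A * y\<^sup>2))) \<longlongrightarrow> 0) at_top"
    using A by real_asymp
  then show ?thesis using True by (simp add: q_kernel_1)
next
  case False
  define c where "c = (q - 1) * A"
  define p where "p = 1 / (q - 1)"
  have "c > 0" "p > 1/2" using False q A assms by (auto simp: c_def p_def field_simps)
  then have "((\<lambda>y. y * (1 + c * y\<^sup>2) powr (- p)) \<longlongrightarrow> 0) at_top"
    by real_asymp
  then show ?thesis using False q A by (simp add: q_kernel_eq_powr c_def p_def)
qed

section \<open>Integrals of powers of the kernel\<close>

context
  assumes int1: "integrable lborel (q_kernel q 1)"
begin

lemma integrable_q_kernel: "integrable lborel (q_kernel q A)"
  using lborel_integrable_real_affine[OF int1, of "sqrt A" 0] A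
  by (simp add: q_kernel_sqrt[symmetric])

lemma integral_q_kernel: "(LBINT y. q_kernel q A y) = q_const q / sqrt A"
proof -
  have "q_const q = (LBINT y. q_kernel q 1 y)"
    by (simp add: q_const_def q_kernel_def)
  also have "\<dots> = sqrt A * (LBINT y. q_kernel q A y)"
    using lborel_integral_real_affine[of "sqrt A" "q_kernel q 1" 0] A
    by (simp add: q_kernel_sqrt[symmetric])
  finally show ?thesis using A by simp
qed

lemma integrable_q_kernel_powr:
  assumes "1 \<le> r"
  shows "integrable lborel (\<lambda>y. q_kernel q A y powr r)"
proof (rule Bochner_Integration.integrable_bound[OF integrable_q_kernel])
  have "q_kernel q A y powr r \<le> q_kernel q A y" for y
    using powr_mono'[OF assms, of "q_kernel q A y"] q_kernel_le_1[of y] q_kernel_pos[of y]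
    by simp
  then show "AE y in lborel. norm (q_kernel q A y powr r) \<le> norm (q_kernel q A y)"
    using q_kernel_pos by (simp add: less_imp_le)
qed simp

end

end

text \<open>For \<open>q > 1\<close>, \<open>q_kernel_powr_split\<close> bounds the integrand by a multiple of the integrable
  function \<open>q_kernel q A y powr r\<close>. For \<open>q = 1\<close> the quadratic factor there is constant; instead,
  half of the Gaussian exponent is used to absorb \<open>y\<^sup>2\<close>.\<close>

lemma integrable_square_q_kernel_powr:
  assumes q: "1 \<le> q" and A: "0 < A" and int1: "integrable lborel (q_kernel q 1)"
    and "1 \<le> r"
  shows "integrable lborel (\<lambda>y. y\<^sup>2 * q_kernel q A y powr (r + q - 1))"
proof (cases "q = 1")
  case True
  have "integrable lborel (\<lambda>y. 2 / A * q_kernel q (A / 2) y)"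
    using integrable_q_kernel[OF q, of "A / 2"] A int1 by simp
  then show ?thesis
  proof (rule Bochner_Integration.integrable_bound)
    have "y\<^sup>2 * q_kernel q A y powr r \<le> 2 / A * q_kernel q (A / 2) y" for y
    proof -
      have "q_kernel q A y powr r \<le> q_kernel q A y"
        using powr_mono'[OF \<open>1 \<le> r\<close>, of "q_kernel q A y"]
          q_kernel_le_1[OF q A, of y] q_kernel_pos[OF q A, of y]
        by simp
      then have "y\<^sup>2 * q_kernel q A y powr r \<le> y\<^sup>2 * exp (- (A * y\<^sup>2))"
        using True by (intro mult_left_mono) (auto simp: q_kernel_1)
      also have "\<dots> = 2 / A * (A / 2 * y\<^sup>2 * exp (- (A / 2 * y\<^sup>2))) * exp (- (A / 2 * y\<^sup>2))"
        using A by (simp flip: exp_add)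
      also have "\<dots> \<le> 2 / A * 1 * exp (- (A / 2 * y\<^sup>2))"
      proof (intro mult_right_mono mult_left_mono)
        show "A / 2 * y\<^sup>2 * exp (- (A / 2 * y\<^sup>2)) \<le> 1"
          using exp_ge_add_one_self[of "A / 2 * y\<^sup>2"] by (simp add: exp_minus field_simps)
      qed (use A in auto)
      finally show ?thesis using True by (simp add: q_kernel_1)
    qed
    then show "AE y in lborel. norm (y\<^sup>2 * q_kernel q A y powr (r + q - 1))
        \<le> norm (2 / A * q_kernel q (A / 2) y)"
      using True A q_kernel_pos[of q "A / 2"] by (simp add: less_imp_le)
  qed (use q A in measurable)
next
  case False
  with q have q1: "q > 1" by simp
  have "integrable lborel (\<lambda>y. 1 / ((q - 1) * A) * q_kernel q A y powr r)"
    using integrable_q_kernel_powr[OF q A int1 \<open>1 \<le> r\<close>] by simp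
  then show ?thesis
  proof (rule Bochner_Integration.integrable_bound)
    have "y\<^sup>2 * q_kernel q A y powr (r + q - 1) \<le> 1 / ((q - 1) * A) * q_kernel q A y powr r" for y
      unfolding q_kernel_powr_split[OF q A, of y r] using q1 A by (simp add: field_simps)
    then show "AE y in lborel. norm (y\<^sup>2 * q_kernel q A y powr (r + q - 1))
        \<le> norm (1 / ((q - 1) * A) * q_kernel q A y powr r)"
      using q1 A by simp
  qed (use q A in measurable)
qed

text \<open>Let \<open>E\<close> be the kernel. The derivative of \<open>y * E powr r\<close> is \<open>E powr r - 2 * A * r * y\<^sup>2 * E powr (r + q - 1)\<close>, and its
  integral over the line vanishes because \<open>y * E powr r\<close> tends to zero at both ends. This is the
  first equation; inserting it into the integral of \<open>q_kernel_powr_split\<close> gives the second. The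
  first moment vanishes by symmetry.\<close>

lemma q_kernel_powr_moments:
  assumes q: "1 \<le> q" and q3: "q < 3" and A: "0 < A"
    and int1: "integrable lborel (q_kernel q 1)" and r: "1 \<le> r"
  shows "(LBINT y. y\<^sup>2 * q_kernel q A y powr (r + q - 1))
           = (LBINT y. q_kernel q A y powr r) / (2 * A * r)"
    and "(LBINT y. q_kernel q A y powr (r + q - 1))
           = (1 - (q - 1) / (2 * r)) * (LBINT y. q_kernel q A y powr r)"
    and "(LBINT y. y * q_kernel q A y powr (r + q - 1)) = 0"
    and "integrable lborel (\<lambda>y. y * q_kernel q A y powr (r + q - 1))"
proof -
  define E where "E = q_kernel q A"
  define s where "s = r + q - 1"
  note pos = q_kernel_pos[OF q A, folded E_def]
  have [measurable]: "E \<in> borel_measurable borel"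
    unfolding E_def using q A by (rule measurable_q_kernel)
  have intr: "integrable lborel (\<lambda>y. E y powr r)"
    unfolding E_def using q A int1 r by (rule integrable_q_kernel_powr)
  have ints: "integrable lborel (\<lambda>y. E y powr s)"
    unfolding E_def using q A int1 by (rule integrable_q_kernel_powr) (use q r in \<open>simp add: s_def\<close>)
  have int2: "integrable lborel (\<lambda>y. y\<^sup>2 * E y powr s)"
    unfolding E_def s_def using q A int1 r by (rule integrable_square_q_kernel_powr)
  \<comment> \<open>the derivative of \<open>y * E y powr r\<close>\<close>
  define g where "g y = E y powr r - 2 * A * r * (y\<^sup>2 * E y powr s)" for y
  have intg: "integrable lborel g"
    unfolding g_def using intr int2 by simp
  have lim: "((\<lambda>y. y * E y powr r) \<longlongrightarrow> 0) at_top"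
  proof (rule tendsto_sandwich[OF _ _ tendsto_const tendsto_mult_q_kernel[OF q A q3]])
    show "\<forall>\<^sub>F y in at_top. y * E y powr r \<le> y * q_kernel q A y"
      using eventually_ge_at_top[of 0]
    proof eventually_elim
      case (elim y)
      then show ?case
        using powr_mono'[OF r, of "E y"] q_kernel_le_1[OF q A, of y] pos[of y]
        by (intro mult_left_mono) (auto simp: E_def)
    qed
    show "\<forall>\<^sub>F y in at_top. 0 \<le> y * E y powr r"
      using eventually_ge_at_top[of 0] by eventually_elim simp
  qed
  have lim': "((\<lambda>y. y * E y powr r) \<longlongrightarrow> 0) at_bot"
    using tendsto_minus[OF lim] unfolding filterlim_at_bot_mirror
    by (simp add: E_def q_kernel_minus)
  have "(LBINT y=-\<infinity>..\<infinity>. g y) = 0 - 0"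
  proof (rule interval_integral_FTC_integrable)
    show "((\<lambda>y. y * E y powr r) has_vector_derivative g y) (at y)" for y
      unfolding has_real_derivative_iff_has_vector_derivative[symmetric] E_def g_def s_def
      using DERIV_mult[OF DERIV_ident DERIV_q_kernel_powr[OF q A, of r y]]
      by (simp add: power2_eq_square algebra_simps)
    show "isCont g y" for y
      unfolding g_def E_def
      by (intro continuous_intros continuous_q_kernel_powr[OF q A])
    show "set_integrable lborel (einterval (-\<infinity>) \<infinity>) g"
      using intg by (simp add: set_integrable_def)
    show "(((\<lambda>y. y * E y powr r) \<circ> real_of_ereal) \<longlongrightarrow> 0) (at_right (-\<infinity>))"
      "(((\<lambda>y. y * E y powr r) \<circ> real_of_ereal) \<longlongrightarrow> 0) (at_left \<infinity>)"
      using lim lim' by (simp_all add: ereal_tendsto_simps)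
  qed simp
  then have "(LBINT y. g y) = 0"
    by (simp add: interval_lebesgue_integral_def set_lebesgue_integral_def)
  then have eq2: "2 * A * r * (LBINT y. y\<^sup>2 * E y powr s) = (LBINT y. E y powr r)"
    using intr int2 by (simp add: g_def)
  then show m2: "(LBINT y. y\<^sup>2 * q_kernel q A y powr (r + q - 1))
           = (LBINT y. q_kernel q A y powr r) / (2 * A * r)"
    unfolding E_def s_def using A r by (simp add: field_simps)
  have "(LBINT y. E y powr r) = (LBINT y. E y powr s + (q - 1) * A * (y\<^sup>2 * E y powr s))"
    by (rule Bochner_Integration.integral_cong)
      (simp_all add: E_def s_def q_kernel_powr_split[OF q A, of _ r] algebra_simps)
  also have "\<dots> = (LBINT y. E y powr s) + (q - 1) * A * (LBINT y. y\<^sup>2 * E y powr s)"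
    using ints int2 by simp
  also have "(q - 1) * A * (LBINT y. y\<^sup>2 * E y powr s) = (q - 1) / (2 * r) * (LBINT y. E y powr r)"
    unfolding eq2[symmetric] using r by simp
  finally show "(LBINT y. q_kernel q A y powr (r + q - 1))
           = (1 - (q - 1) / (2 * r)) * (LBINT y. q_kernel q A y powr r)"
    unfolding E_def s_def left_diff_distrib by linarith
  have "integrable lborel (\<lambda>y. E y powr s + y\<^sup>2 * E y powr s)"
    using ints int2 by simp
  then show "integrable lborel (\<lambda>y. y * q_kernel q A y powr (r + q - 1))"
    unfolding E_def[symmetric] s_def[symmetric]
  proof (rule Bochner_Integration.integrable_bound)
    have "\<bar>y\<bar> * E y powr s \<le> E y powr s + y\<^sup>2 * E y powr s" for y
    proof -
      have "\<bar>y\<bar> \<le> 1 + y\<^sup>2"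
        using zero_le_power2[of "\<bar>y\<bar> - 1"] by (simp add: power2_diff)
      then have "\<bar>y\<bar> * E y powr s \<le> (1 + y\<^sup>2) * E y powr s"
        by (rule mult_right_mono) simp
      then show ?thesis by (simp add: distrib_right)
    qed
    then show "AE y in lborel. norm (y * E y powr s) \<le> norm (E y powr s + y\<^sup>2 * E y powr s)"
      by (simp add: abs_mult)
  qed measurable
  show "(LBINT y. y * q_kernel q A y powr (r + q - 1)) = 0"
    using lborel_integral_real_affine[of "-1" "\<lambda>y. y * q_kernel q A y powr (r + q - 1)" 0]
    by (simp add: q_kernel_minus)
qed

text \<open>If \<open>D = 1 + (1 - q) * K\<close> is positive, then \<open>q_exp_add\<close> splits off \<open>q_exp q K\<close> and the
  remaining kernel for \<open>A / D\<close> has integral \<open>sqrt D * q_const q / sqrt A\<close>. Otherwise the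
  right-hand side is infinite, and the integral exceeds every \<open>t > 0\<close>: by monotonicity it is at
  least the integral for each smaller \<open>k\<close> at which the q-exponential is still finite, and the
  value \<open>e\<close> of \<open>q_exp q k\<close> may be prescribed arbitrarily by \<open>k = q_ln q e\<close>.\<close>

lemma nn_integral_q_exp_quadratic:
  assumes q: "1 \<le> q" and q3: "q < 3" and A: "0 < A"
    and int1: "integrable lborel (q_kernel q 1)" and C: "0 < q_const q"
  shows "(\<integral>\<^sup>+ y. q_exp q (K - A * y\<^sup>2) \<partial>lborel)
           = ennreal_powr (q_exp q K) ((3 - q) / 2) * ennreal (q_const q / sqrt A)"
proof -
  have kernel: "(\<integral>\<^sup>+ y. q_exp q (- (B * y\<^sup>2)) \<partial>lborel) = ennreal (q_const q / sqrt B)"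
    if "0 < B" for B
    using nn_integral_eq_integral[OF integrable_q_kernel[OF q that int1]]
      q_kernel_pos[OF q that]
    by (simp add: ennreal_q_kernel[OF q that] integral_q_kernel[OF q that int1] less_imp_le)
  have finite: "(\<integral>\<^sup>+ y. q_exp q (k - A * y\<^sup>2) \<partial>lborel)
      = ennreal (e powr ((3 - q) / 2) * (q_const q / sqrt A))"
    if e: "0 < e" "q_exp q k = ennreal e" "e powr (1 - q) = 1 + (1 - q) * k" for k e
  proof -
    define D where "D = 1 + (1 - q) * k"
    have D: "D = e powr (1 - q)" "D > 0" using e by (simp_all add: D_def flip: e(3))
    have "q_exp q (k - A * y\<^sup>2) = ennreal e * q_exp q (- (A / D * y\<^sup>2))" for y
      using q_exp_add[OF q, of k "- (A * y\<^sup>2)"] D(2) e(2) by (simp flip: D_def)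
    moreover have "(\<lambda>y. q_exp q (- (A / D * y\<^sup>2))) \<in> borel_measurable borel"
      unfolding q_exp_def q_bracket_def by measurable
    ultimately have "(\<integral>\<^sup>+ y. q_exp q (k - A * y\<^sup>2) \<partial>lborel)
        = ennreal e * ennreal (q_const q / sqrt (A / D))"
      using kernel[of "A / D"] A D(2) by (simp add: nn_integral_cmult)
    also have "\<dots> = ennreal (e * sqrt D * (q_const q / sqrt A))"
      using e(1) A C D(2) by (simp add: real_sqrt_divide flip: ennreal_mult)
    also have "e * sqrt D = e powr 1 * e powr ((1 - q) / 2)"
      using e(1) unfolding D(1) by (simp add: powr_half_sqrt[symmetric] powr_powr)
    also have "\<dots> = e powr ((3 - q) / 2)"
      unfolding powr_add[symmetric] by (simp add: field_simps)
    finally show ?thesis .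
  qed
  show ?thesis
  proof (cases "0 < 1 + (1 - q) * K")
    case True
    from q_exp_powr[OF q True] obtain e where
      e: "0 < e" "q_exp q K = ennreal e" "e powr (1 - q) = 1 + (1 - q) * K" .
    show ?thesis
      unfolding finite[OF e] using e A C by (subst ennreal_mult) (simp_all add: ennreal_powr_def)
  next
    case False
    have q1: "1 < q" using q False by (cases "q = 1") auto
    define c where "c = q_const q / sqrt A"
    have c: "0 < c" using A C by (simp add: c_def)
    have ge: "ennreal t \<le> (\<integral>\<^sup>+ y. q_exp q (K - A * y\<^sup>2) \<partial>lborel)" if "0 < t" for t
    proof -
      \<comment> \<open>the \<open>e\<close> for which the finite case yields exactly \<open>t\<close>\<close>
      have exponent: "2 / (3 - q) * ((3 - q) / 2) = 1" using q3 by simp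
      define e where "e = (t / c) powr (2 / (3 - q))"
      have e: "0 < e" "e powr ((3 - q) / 2) * c = t"
        using that c exponent by (simp_all only: e_def powr_powr) simp_all
      define k where "k = q_ln q e"
      have k: "1 + (1 - q) * k = e powr (1 - q)"
        unfolding k_def using e(1) by (rule one_plus_q_ln)
      then have "(1 - q) * K < (1 - q) * k"
        using False e(1) powr_gt_zero[of e "1 - q"] by linarith
      then have "k \<le> K" using q1 by (simp add: mult_less_cancel_left)
      have "ennreal t = (\<integral>\<^sup>+ y. q_exp q (k - A * y\<^sup>2) \<partial>lborel)"
        using finite[of e k] e k q_exp_q_ln[of e q] by (simp add: c_def k_def)
      also have "\<dots> \<le> (\<integral>\<^sup>+ y. q_exp q (K - A * y\<^sup>2) \<partial>lborel)"
        using \<open>k \<le> K\<close> q by (intro nn_integral_mono q_exp_mono) auto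
      finally show ?thesis .
    qed
    have "(\<integral>\<^sup>+ y. q_exp q (K - A * y\<^sup>2) \<partial>lborel) = \<infinity>"
    proof (rule ccontr)
      assume "(\<integral>\<^sup>+ y. q_exp q (K - A * y\<^sup>2) \<partial>lborel) \<noteq> \<infinity>"
      then obtain r where "0 \<le> r" "(\<integral>\<^sup>+ y. q_exp q (K - A * y\<^sup>2) \<partial>lborel) = ennreal r"
        by (cases "\<integral>\<^sup>+ y. q_exp q (K - A * y\<^sup>2) \<partial>lborel") auto
      with ge[of "r + 1"] show False by simp
    qed
    moreover have "q_exp q K = \<infinity>"
      using False q1 by (simp add: q_exp_def q_bracket_def)
    ultimately show ?thesis
      using A C by (simp add: ennreal_powr_def ennreal_top_mult)
  qed
qed

section \<open>Laplace transform and moments of a shifted and scaled kernel\<close>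

lemma q_ln_q_kernel:
  assumes "1 \<le> q" and "0 < A"
  shows "q_ln q (q_kernel q A y) = - (A * y\<^sup>2)"
proof (cases "q = 1")
  case True
  then show ?thesis by (simp add: q_ln_def q_kernel_1)
next
  case False
  then show ?thesis
    unfolding q_ln_def q_kernel_powr_1_minus[OF assms] by (simp add: field_simps)
qed

text \<open>In the exponent of the q-product the kernel contributes its q-logarithm, which is a multiple
  of \<open>y\<^sup>2\<close>. Pulling the amplitude \<open>a\<close> out as an ordinary factor multiplies \<open>u\<close> by
  \<open>a powr (q - 1)\<close>.\<close>

lemma q_exp_prod_q_kernel:
  assumes q: "1 \<le> q" and A: "0 < A" and a: "0 < a"
  shows "q_exp_prod q u (a * q_kernel q A y)
           = ennreal a * q_exp q (a powr (q - 1) * u - A * y\<^sup>2)"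
proof -
  have "a powr (1 - q) * a powr (q - 1) = 1"
    using a by (simp flip: powr_add)
  then have "a powr (1 - q) * (a powr (q - 1) * u - A * y\<^sup>2) = u - a powr (1 - q) * (A * y\<^sup>2)"
    by (simp add: right_diff_distrib flip: mult.assoc)
  then have "u + q_ln q (a * q_kernel q A y)
      = q_ln q a + a powr (1 - q) * (a powr (q - 1) * u - A * y\<^sup>2)"
    using q_ln_mult[OF a q_kernel_pos[OF q A], of q y] by (simp add: q_ln_q_kernel[OF q A])
  then show ?thesis
    unfolding q_exp_prod_def by (simp only: q_exp_q_ln_add[OF q a])
qed

text \<open>By \<open>q_exp_prod_q_kernel\<close> the exponent is a quadratic polynomial in \<open>x\<close>; it has its vertex at
  \<open>m + h\<close>, where \<open>h = \<theta> * a powr (q - 1) / (2 * A)\<close>, and its maximum \<open>K\<close> is the exponent on the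
  right-hand side. The assumption \<open>mass\<close> says that \<open>a\<close> times the kernel has integral one, and
  cancels the constant factors.\<close>

lemma nn_integral_q_exp_prod_q_kernel:
  assumes q: "1 \<le> q" and q3: "q < 3" and A: "0 < A" and a: "0 < a"
    and int1: "integrable lborel (q_kernel q 1)"
    and mass: "a * (q_const q / sqrt A) = 1"
  shows "(\<integral>\<^sup>+ x. q_exp_prod q (\<theta> * x) (a * q_kernel q A (x - m)) \<partial>lborel)
    = ennreal_powr (q_exp q (\<theta> * m * a powr (q - 1) + \<theta>\<^sup>2 * a powr (2 * q - 2) / (4 * A))) ((3 - q) / 2)"
proof -
  define b where "b = \<theta> * a powr (q - 1)"
  define h where "h = b / (2 * A)"
  define K where "K = b * m + b\<^sup>2 / (4 * A)"
  have C: "0 < q_const q"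
    using mass a A by (smt (verit) divide_nonpos_pos mult_nonneg_nonpos real_sqrt_gt_zero)
  have "a powr (2 * q - 2) = (a powr (q - 1))\<^sup>2"
    using a by (simp add: powr_power)
  then have K: "\<theta> * m * a powr (q - 1) + \<theta>\<^sup>2 * a powr (2 * q - 2) / (4 * A) = K"
    by (simp add: K_def b_def power_mult_distrib)
  have square: "a powr (q - 1) * (\<theta> * (m + h + y)) - A * (m + h + y - m)\<^sup>2 = K - A * y\<^sup>2" for y
    using A by (simp add: K_def h_def b_def power2_eq_square field_simps)
  have [measurable]: "(\<lambda>x. q_exp q (a powr (q - 1) * (\<theta> * x) - A * (x - m)\<^sup>2)) \<in> borel_measurable borel"
    "(\<lambda>y. q_exp q (K - A * y\<^sup>2)) \<in> borel_measurable borel"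
    unfolding q_exp_def q_bracket_def by measurable
  have "(\<integral>\<^sup>+ x. q_exp_prod q (\<theta> * x) (a * q_kernel q A (x - m)) \<partial>lborel)
      = ennreal a * (\<integral>\<^sup>+ x. q_exp q (a powr (q - 1) * (\<theta> * x) - A * (x - m)\<^sup>2) \<partial>lborel)"
    by (simp add: q_exp_prod_q_kernel[OF q A a] nn_integral_cmult)
  also have "(\<integral>\<^sup>+ x. q_exp q (a powr (q - 1) * (\<theta> * x) - A * (x - m)\<^sup>2) \<partial>lborel)
      = (\<integral>\<^sup>+ y. q_exp q (K - A * y\<^sup>2) \<partial>lborel)"
    using nn_integral_real_affine[of "\<lambda>x. q_exp q (a powr (q - 1) * (\<theta> * x) - A * (x - m)\<^sup>2)" 1 "m + h"]
    by (simp add: square[simplified])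
  also have "\<dots> = ennreal_powr (q_exp q K) ((3 - q) / 2) * ennreal (q_const q / sqrt A)"
    by (rule nn_integral_q_exp_quadratic[OF q q3 A int1 C])
  also have "ennreal a * \<dots> = ennreal_powr (q_exp q K) ((3 - q) / 2) * ennreal (a * (q_const q / sqrt A))"
    using a A C by (subst ennreal_mult) (auto simp: mult_ac)
  finally show ?thesis by (simp only: mass K ennreal_1 mult_1_right)
qed

text \<open>A density is determined only almost everywhere, so the function \<open>f\<close> is any version of it.\<close>

lemma unnorm_moment_AE_q_kernel:
  assumes q: "1 \<le> q" and A: "0 < A" and a: "0 < a"
    and [measurable]: "f \<in> borel_measurable borel"
    and f: "AE x in lborel. f x = a * q_kernel q A (x - m)"
    and int: "integrable lborel (\<lambda>y. (m + y) ^ k * q_kernel q A y powr s)"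
  shows "integrable lborel (unnorm_moment_integrand s k f)"
    and "unnorm_moment s k f = a powr s * (LBINT y. (m + y) ^ k * q_kernel q A y powr s)"
proof -
  define h where "h y = (m + y) ^ k * q_kernel q A y powr s" for y
  have [measurable]: "q_kernel q A \<in> borel_measurable borel"
    using q A by (rule measurable_q_kernel)
  have eq: "AE x in lborel. unnorm_moment_integrand s k f x = a powr s * h (- m + 1 * x)"
    using f
  proof eventually_elim
    case (elim x)
    then show ?case
      using a q_kernel_pos[OF q A, of "x - m"]
      by (simp add: unnorm_moment_integrand_def h_def powr_mult)
  qed
  have meas: "unnorm_moment_integrand s k f \<in> borel_measurable borel" "h \<in> borel_measurable borel"
    unfolding unnorm_moment_integrand_def h_def by measurable
  have inth: "integrable lborel (\<lambda>x. a powr s * h (- m + 1 * x))"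
    using int unfolding h_def[symmetric]
    by (intro integrable_mult_right lborel_integrable_real_affine) simp_all
  show "integrable lborel (unnorm_moment_integrand s k f)"
  proof (rule integrable_cong_AE_imp[OF inth])
    show "AE x in lborel. a powr s * h (- m + 1 * x) = unnorm_moment_integrand s k f x"
      using eq by eventually_elim (rule sym)
  qed (use meas in simp)
  have "unnorm_moment s k f = (LBINT x. a powr s * h (- m + 1 * x))"
    unfolding unnorm_moment_def
    by (rule integral_cong_AE) (use meas eq in \<open>auto simp: unnorm_moment_integrand_def\<close>)
  also have "\<dots> = a powr s * (LBINT y. h y)"
    using lborel_integral_real_affine[of 1 h "- m"] by simp
  finally show "unnorm_moment s k f = a powr s * (LBINT y. (m + y) ^ k * q_kernel q A y powr s)"
    by (simp add: h_def)
qed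

text \<open>Expanding \<open>(m + y) ^ k\<close> reduces these to \<open>q_kernel_powr_moments\<close>, with \<open>r = 1\<close> for the
  power \<open>q\<close> and \<open>r = q\<close> for the power \<open>2 * q - 1\<close>.\<close>

lemma shifted_q_kernel_moments:
  assumes q: "1 \<le> q" and q3: "q < 3" and A: "0 < A"
    and int1: "integrable lborel (q_kernel q 1)"
  shows "integrable lborel (\<lambda>y. (m + y) ^ 1 * q_kernel q A y powr q)"
    and "(LBINT y. (m + y) ^ 1 * q_kernel q A y powr q) = m * (3 - q) / 2 * (q_const q / sqrt A)"
    and "integrable lborel (\<lambda>y. (m + y)\<^sup>2 * q_kernel q A y powr (2 * q - 1))"
    and "(LBINT y. (m + y)\<^sup>2 * q_kernel q A y powr (2 * q - 1))
      = ((q + 1) * m\<^sup>2 + 1 / A) / (2 * q) * ((3 - q) / 2 * (q_const q / sqrt A))"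
proof -
  note mom1 = q_kernel_powr_moments[OF q q3 A int1, of 1, simplified]
  note momq = q_kernel_powr_moments[OF q q3 A int1 q]
  have s: "q + q - 1 = 2 * q - 1" by simp
  \<comment> \<open>the simplifier has turned the power with exponent one into an absolute value in \<open>mom1\<close>\<close>
  have E: "\<bar>q_kernel q A y\<bar> = q_kernel q A y" for y
    using q_kernel_pos[OF q A, of y] by simp
  have I0: "(LBINT y. q_kernel q A y powr q) = (3 - q) / 2 * (q_const q / sqrt A)"
    using mom1(2) by (simp add: E integral_q_kernel[OF q A int1] field_simps)
  note integrables [simp] = mom1(4) momq(4)[unfolded s]
    integrable_q_kernel_powr[OF q A int1 q]
    integrable_q_kernel_powr[OF q A int1, of "2 * q - 1"]
    integrable_square_q_kernel_powr[OF q A int1 q, unfolded s]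
  have q': "1 \<le> 2 * q - 1" using q by simp
  have eq1: "(m + y) ^ 1 * q_kernel q A y powr q
      = m * q_kernel q A y powr q + y * q_kernel q A y powr q" for y
    by (simp add: distrib_right)
  show "integrable lborel (\<lambda>y. (m + y) ^ 1 * q_kernel q A y powr q)"
    unfolding eq1 by simp
  show "(LBINT y. (m + y) ^ 1 * q_kernel q A y powr q) = m * (3 - q) / 2 * (q_const q / sqrt A)"
    unfolding eq1 using mom1(3) by (simp add: I0)
  have eq2: "(m + y)\<^sup>2 * q_kernel q A y powr (2 * q - 1)
      = m\<^sup>2 * q_kernel q A y powr (2 * q - 1) + 2 * m * (y * q_kernel q A y powr (2 * q - 1))
        + y\<^sup>2 * q_kernel q A y powr (2 * q - 1)" for y
    by (simp add: power2_sum algebra_simps)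
  show "integrable lborel (\<lambda>y. (m + y)\<^sup>2 * q_kernel q A y powr (2 * q - 1))"
    unfolding eq2 using q' by simp
  show "(LBINT y. (m + y)\<^sup>2 * q_kernel q A y powr (2 * q - 1))
      = ((q + 1) * m\<^sup>2 + 1 / A) / (2 * q) * ((3 - q) / 2 * (q_const q / sqrt A))"
  proof -
    define I where "I = (3 - q) / 2 * (q_const q / sqrt A)"
    have "(LBINT y. (m + y)\<^sup>2 * q_kernel q A y powr (2 * q - 1))
        = m\<^sup>2 * ((1 - (q - 1) / (2 * q)) * I) + I / (2 * A * q)"
      unfolding eq2 using q' momq(1,2,3)[unfolded s] by (simp add: I0 I_def)
    also have "\<dots> = ((q + 1) * m\<^sup>2 + 1 / A) / (2 * q) * I"
      using q A by (simp add: field_simps)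
    finally show ?thesis by (simp only: I_def)
  qed
qed

section \<open>The q-Gaussian distribution\<close>

lemma q_gaussian_density_eq_q_kernel:
  "q_gaussian_density q m \<sigma> x
     = sqrt (q_beta q) / (\<sigma> * q_const q) * q_kernel q (q_beta q / \<sigma>\<^sup>2) (x - m)"
  by (simp add: q_gaussian_density_def q_kernel_def)

text \<open>The integral of a non-integrable function is zero by convention, and division by zero yields
  zero. Hence if \<open>q_const q\<close> were zero, for whatever reason, the density would vanish identically
  and could not have mass one. A nonzero integral, in turn, belongs to an integrable function.\<close>

lemma q_gaussian_normalizable:
  assumes "prob_space M"
    and X: "distributed M lborel X (\<lambda>x. ennreal (q_gaussian_density q m \<sigma> x))"
  shows "0 < q_const q" and "integrable lborel (q_kernel q 1)"
proof -
  interpret prob_space M by fact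
  have C: "q_const q = (LBINT x. q_kernel q 1 x)"
    by (simp add: q_const_def q_kernel_def)
  have "q_const q \<noteq> 0"
  proof
    assume "q_const q = 0"
    then have "(\<integral>\<^sup>+ x. ennreal (q_gaussian_density q m \<sigma> x) * 1 \<partial>lborel) = 0"
      by (simp add: q_gaussian_density_def)
    moreover have "(\<integral>\<^sup>+ x. ennreal (q_gaussian_density q m \<sigma> x) * 1 \<partial>lborel) = 1"
      using distributed_nn_integral[OF X, of "\<lambda>_. 1"] emeasure_space_1 by simp
    ultimately show False by simp
  qed
  moreover have "0 \<le> q_const q"
    unfolding C by (simp add: q_kernel_def)
  ultimately show "0 < q_const q" by simp
  show "integrable lborel (q_kernel q 1)"
    using \<open>q_const q \<noteq> 0\<close> not_integrable_integral_eq unfolding C by blast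
qed

theorem theorem5p4:
  fixes q m \<sigma> a :: real and M :: "'a measure" and X :: "'a \<Rightarrow> real" and f :: "real \<Rightarrow> real"
  assumes "1 \<le> q" and "q < 3" and "\<sigma> > 0"
    and "prob_space M"
    and X_gaussian: "distributed M lborel X (\<lambda>x. ennreal (q_gaussian_density q m \<sigma> x))"
    and f_nonneg: "\<And>x. 0 \<le> f x"
    and f_density: "distributed M lborel X (\<lambda>x. ennreal (f x))"
    and a_eq: "a = sqrt (q_beta q) / (\<sigma> * q_const q)"
  shows "(\<forall>\<theta>. q_laplace q f \<theta> =
           ennreal_powr
             (q_exp q (\<theta> * m * a powr (q - 1)
                        + \<theta>\<^sup>2 * a powr (2 * q - 2) * \<sigma>\<^sup>2 / (4 * q_beta q)))
             ((3 - q) / 2)) \<and>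
         integrable lborel (unnorm_moment_integrand q 1 f) \<and>
         unnorm_moment q 1 f =
           m * (3 - q) powr ((3 - q) / 2) / (2 * (\<sigma> * q_const q) powr (q - 1)) \<and>
         integrable lborel (unnorm_moment_integrand (2 * q - 1) 2 f) \<and>
         unnorm_moment (2 * q - 1) 2 f =
           1 / (4 * q * (3 - q) powr (q - 2) * (\<sigma> * q_const q) powr (2 * q - 2))
             * ((3 - q) * \<sigma>\<^sup>2 + (q + 1) * m\<^sup>2)"
proof -
  interpret prob_space M by fact
  note q = \<open>1 \<le> q\<close> and q3 = \<open>q < 3\<close>
  define A where "A = q_beta q / \<sigma>\<^sup>2"
  have \<beta>: "q_beta q > 0" using q3 by (simp add: q_beta_def)
  have A: "0 < A" using \<beta> \<open>\<sigma> > 0\<close> by (simp add: A_def)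
  note C = q_gaussian_normalizable(1)[OF \<open>prob_space M\<close> X_gaussian]
    and int1 = q_gaussian_normalizable(2)[OF \<open>prob_space M\<close> X_gaussian]
  have a: "0 < a" using \<beta> C \<open>\<sigma> > 0\<close> by (simp add: a_eq)
  have mass: "a * (q_const q / sqrt A) = 1"
    using \<beta> C \<open>\<sigma> > 0\<close> by (simp add: a_eq A_def real_sqrt_divide)
  have f_AE: "AE x in lborel. f x = a * q_kernel q A (x - m)"
    using distributed_unique[OF f_density X_gaussian]
  proof eventually_elim
    case (elim x)
    then show ?case
      using f_nonneg[of x] a q_kernel_pos[OF q A, of "x - m"]
      by (simp add: q_gaussian_density_eq_q_kernel flip: a_eq A_def)
  qed
  have f_measurable: "f \<in> borel_measurable borel"
  proof -
    have "(\<lambda>x. enn2real (ennreal (f x))) \<in> borel_measurable lborel"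
      using distributed_borel_measurable[OF f_density] by measurable
    then show ?thesis using f_nonneg by simp
  qed
  have laplace: "q_laplace q f \<theta> =
      ennreal_powr (q_exp q (\<theta> * m * a powr (q - 1)
        + \<theta>\<^sup>2 * a powr (2 * q - 2) * \<sigma>\<^sup>2 / (4 * q_beta q))) ((3 - q) / 2)" for \<theta>
  proof -
    have "q_laplace q f \<theta> = (\<integral>\<^sup>+ x. q_exp_prod q (\<theta> * x) (a * q_kernel q A (x - m)) \<partial>lborel)"
      unfolding q_laplace_def
    proof (rule nn_integral_cong_AE, use f_AE in eventually_elim)
      case (elim x)
      then have "f x \<noteq> 0"
        using a q_kernel_pos[OF q A, of "x - m"] by simp
      with elim show ?case by (simp add: support_on_def)
    qed
    also have "\<dots> = ennreal_powr (q_exp q (\<theta> * m * a powr (q - 1)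
        + \<theta>\<^sup>2 * a powr (2 * q - 2) / (4 * A))) ((3 - q) / 2)"
      by (rule nn_integral_q_exp_prod_q_kernel[OF q q3 A a int1 mass])
    finally show ?thesis by (simp add: A_def)
  qed
  have a_powr: "a powr p = (3 - q) powr (- (p / 2)) / (\<sigma> * q_const q) powr p" for p
  proof -
    have "(3 - q) powr (- (1 / 2)) = 1 / sqrt (3 - q)"
      using q3 by (simp add: powr_minus_divide powr_half_sqrt)
    then have "sqrt (q_beta q) = (3 - q) powr (- (1 / 2))"
      by (simp add: q_beta_def real_sqrt_divide)
    then show ?thesis
      using C \<open>\<sigma> > 0\<close> unfolding a_eq by (subst powr_divide) (simp_all add: powr_powr)
  qed
  \<comment> \<open>the normalisation cancels one factor \<open>a\<close>\<close>
  have a_mass: "a powr s * (t * (q_const q / sqrt A)) = a powr (s - 1) * t" for s t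
  proof -
    have "a powr s = a powr (s - 1) * a"
      using powr_add[of a "s - 1" 1] a by simp
    then have "a powr s * (t * (q_const q / sqrt A))
        = a powr (s - 1) * t * (a * (q_const q / sqrt A))"
      by (simp only: mult_ac)
    then show ?thesis by (simp only: mass mult_1_right)
  qed
  have one: "(3 - q) powr 1 = 3 - q" using q3 by simp
  note moments = shifted_q_kernel_moments[OF q q3 A int1, of m]
  note moment1 = unnorm_moment_AE_q_kernel[OF q A a f_measurable f_AE moments(1)]
  note moment2 = unnorm_moment_AE_q_kernel[OF q A a f_measurable f_AE moments(3)]
  have "unnorm_moment q 1 f = a powr (q - 1) * (m * (3 - q) / 2)"
    unfolding moment1(2) moments(2) by (rule a_mass)
  also have "\<dots> = m * ((3 - q) powr 1 * (3 - q) powr (- ((q - 1) / 2))) / (2 * (\<sigma> * q_const q) powr (q - 1))"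
    unfolding a_powr one by (simp only: mult_ac times_divide_times_eq times_divide_eq_left times_divide_eq_right)
  also have "(3 - q) powr 1 * (3 - q) powr (- ((q - 1) / 2)) = (3 - q) powr ((3 - q) / 2)"
  proof -
    have "1 + - ((q - 1) / 2) = (3 - q) / 2" by (simp add: field_simps)
    then show ?thesis by (simp only: powr_add[symmetric])
  qed
  finally have m1: "unnorm_moment q 1 f
      = m * (3 - q) powr ((3 - q) / 2) / (2 * (\<sigma> * q_const q) powr (q - 1))" .
  define B where "B = (3 - q) * \<sigma>\<^sup>2 + (q + 1) * m\<^sup>2"
  have B: "(q + 1) * m\<^sup>2 + 1 / A = B"
    by (simp add: A_def B_def q_beta_def)
  have alg: "x / y * (b / (2 * q) * (w / 2)) = w * x / (4 * q * y) * b" for x y b w :: real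
    by (simp add: mult_ac)
  have "unnorm_moment (2 * q - 1) 2 f = a powr (2 * q - 2) * (B / (2 * q) * ((3 - q) / 2))"
    using a_mass[of "2 * q - 1" "B / (2 * q) * ((3 - q) / 2)"]
    unfolding moment2(2) moments(4) B by (simp only: mult.assoc) simp
  also have "\<dots> = ((3 - q) powr 1 * (3 - q) powr (- ((2 * q - 2) / 2)))
      / (4 * q * (\<sigma> * q_const q) powr (2 * q - 2)) * B"
    unfolding a_powr one by (rule alg)
  also have "(3 - q) powr 1 * (3 - q) powr (- ((2 * q - 2) / 2)) = 1 / (3 - q) powr (q - 2)"
  proof -
    have "1 + - ((2 * q - 2) / 2) = - (q - 2)" by (simp add: field_simps)
    then show ?thesis by (simp only: powr_add[symmetric] powr_minus_divide[symmetric])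
  qed
  finally have m2: "unnorm_moment (2 * q - 1) 2 f =
      1 / (4 * q * (3 - q) powr (q - 2) * (\<sigma> * q_const q) powr (2 * q - 2))
        * ((3 - q) * \<sigma>\<^sup>2 + (q + 1) * m\<^sup>2)"
    by (simp add: B_def mult_ac)
  show ?thesis
    using laplace moment1(1) m1 moment2(1) m2 by blast
qed

end
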